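(* Let $\mathcal V=(\mathcal V,\le,\otimes,\mathrm k)$ be a (unital, commutative) quantale satisfying (A) $\mathrm k=\bigvee\{\varepsilon\in\mathcal V\mid\varepsilon\lll\mathrm k\}$ or (B) $\mathrm k\wedge(-):\mathcal V\to\mathcal V$ preserves arbitrary joins. Let $s$ be a Cauchy sequence in a $\mathcal V$-normed category $\mathbb X$, and let $\phi_s$ denote the normed colimit of the sequence $\mathrm y_{\mathbb X}\cdot s$ in $\mathcal P\mathbb X$, where $\mathrm y_{\mathbb X}:\mathbb X\to\mathcal P\mathbb X$ is the Yoneda embedding. Then $\mathbb X$ has a normed colimit of $s$ if, and only if, $\mathbb X$ has a $\phi_s$-weighted colimit (of the identity functor of $\mathbb X$).
   Context: A quantale $(\mathcal V,\le,\otimes,\mathrm k)$ is a complete lattice with a commutative monoid structure $(\mathcal V,\otimes,\mathrm k)$ such that each $-\otimes v$ preserves arbitrary joins; $[v,-]$ denotes the right adjoint of $-\otimes v$. For $u,v\in\mathcal V$, $u\lll v$ means: whenever $v\le\bigvee W$ with $W\subseteq\mathcal V$, then $u\le w$ for some $w\in W$. A $\mathcal V$-normed set is a set $A$ with a function $|\cdot|:A\to\mathcal V$. $\mathsf{Set}/\!/\mathcal V$ is the category of $\mathcal V$-normed sets and $\mathcal V$-normed maps, i.e. maps $f$ with $|a|\le|fa|$. It is symmetric monoidal closed, with $A\otimes B=A\times B$ normed by $|(a,b)|=|a|\otimes|b|$. $\mathsf{Set}||\mathcal V$ has the same objects, and arbitrary maps $\varphi:A\to B$ as morphisms, with norm $|\varphi|=\bigwedge_{a\in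 A}[|a|,|\varphi a|]$. A $\mathcal V$-normed category is a category $\mathbb X$ with a value $|f|\in\mathcal V$ for every morphism $f$ such that $\mathrm k\le|1_x|$ and $|f|\otimes|g|\le|g\cdot f|$; equivalently, a category enriched in $\mathsf{Set}/\!/\mathcal V$. A functor $F$ is $\mathcal V$-normed if $|f|\le|Ff|$ for all morphisms $f$. The dual category $\mathbb X^{\mathrm{op}}$ keeps the norms. For $\mathcal V$-normed functors $P,Q$ into a $\mathcal V$-normed category, $\mathrm{Nat}(P,Q)$ is the collection of all natural transformations $P\to Q$, normed by $|\alpha|=\bigwedge_x|\alpha_x|$; these are the hom-objects of the functor category $[\mathbb X^{\mathrm{op}},\mathsf{Set}||\mathcal V]$ of $\mathcal V$-normed functors (formed in a higher universe if necessary). $\mathcal P\mathbb X$ is the full subcategory of $[\mathbb X^{\mathrm{op}},\mathsf{Set}||\mathcal V]$ of accessible presheaves, i.e. of those $\phi$ which are small-weighted colimits of representables. Equivalently, there are a small $\mathcal V$-normed category $\mathbb A$, a fully faithful $\mathcal V$-normed functor $F:\mathbb A\to\mathbb X$ and a $\mathcal V$-normed functor $\psi:\mathbb A^{\mathrm{op}}\to\mathsf{Set}||\mathcal V$ with $\phi\cong\int^{a\in\mathbb A}\psi(a)\otimes\mathbb X(-,Fa)$ (coend in the enriched sense, formed in $\mathsf{Set}/\!/\mathcal V$). For $\mathbb X$ small, $\mathcal P\mathbb X=[\mathbb X^{\mathrm{op}},\mathsf{Set}||\mathcal V]$. The Yoneda embedding is $\mathrm y_{\mathbb X}(x)=\mathbb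 X(-,x)$. Under the hypothesis (A) or (B), $\mathcal P\mathbb X$ is Cauchy cocomplete, so $\phi_s$ exists. A sequence in a $\mathcal V$-normed category is a functor $s:\mathbb N\to\mathbb X$ from the ordered set $\mathbb N$, written $s=(s_{m,n}:x_m\to x_n)_{m\le n}$. It is Cauchy if $\mathrm k\le\bigvee_{N}\bigwedge_{n\ge m\ge N}|s_{m,n}|$. A normed colimit of $s$ is an object $x$ with a cocone $\gamma=(\gamma_n:x_n\to x)_n$ which is a colimit cocone of $s$ in the ordinary category $\mathbb X$ such that $|f|=\bigvee_{N}\bigwedge_{n\ge N}|f\cdot\gamma_n|$ for every morphism $f$ with domain $x$. Cauchy cocomplete means that every Cauchy sequence has a normed colimit. For $\phi:\mathbb X^{\mathrm{op}}\to\mathsf{Set}||\mathcal V$, a $\phi$-weighted colimit in $\mathbb X$ is an object $x$ of $\mathbb X$ together with isomorphisms $\mathbb X(x,y)\cong\mathrm{Nat}(\phi,\mathbb X(-,y))$ in $\mathsf{Set}/\!/\mathcal V$ (i.e. norm-preserving bijections), natural in $y$. *)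

theory Defs
  imports Main "HOL-Library.FuncSet" "HOL-Library.Equipollence"
begin

section \<open>Quantales\<close>

text \<open>The tensor product is written \<open>*\<close> and its neutral element \<open>k\<close> is written \<open>1\<close>.\<close>

class comm_quantale = complete_lattice + comm_monoid_mult +
  assumes Sup_mult_distrib: "Sup W * v = (SUP w\<in>W. w * v)"

text \<open>\<open>residual v\<close> is the right adjoint \<open>[v,-]\<close> of \<open>- * v\<close>.\<close>

definition residual :: "'v::comm_quantale \<Rightarrow> 'v \<Rightarrow> 'v" where
  "residual v w = Sup {u. u * v \<le> w}"

definition totally_below :: "'v::comm_quantale \<Rightarrow> 'v \<Rightarrow> bool" where
  "totally_below u v \<longleftrightarrow> (\<forall>W. v \<le> Sup W \<longrightarrow> (\<exists>w\<in>W. u \<le> w))"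

definition condition_A :: "'v::comm_quantale itself \<Rightarrow> bool" where
  "condition_A _ \<longleftrightarrow> (1::'v) = Sup {\<epsilon>. totally_below \<epsilon> 1}"

definition condition_B :: "'v::comm_quantale itself \<Rightarrow> bool" where
  "condition_B _ \<longleftrightarrow> (\<forall>W::'v set. inf 1 (Sup W) = (SUP w\<in>W. inf 1 w))"


section \<open>Size\<close>

text \<open>
  The elements of small sets are drawn from a type \<open>'u\<close> whose cardinality is uncountable and
  regular, and a set is small if it has fewer elements than \<open>'u\<close>.  If the cardinality of \<open>'u\<close>
  is inaccessible, these are, up to bijection, the members of a Grothendieck universe.  A
  strong limit is not required: no type of HOL can be proved to have an inaccessible
  cardinality, and closure of small sets under powers is not used, because hom-collections of
  presheaf categories live in other types and need not be small.
\<close>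

class set_universe =
  assumes nat_lesspoll_universe: "(UNIV :: nat set) \<prec> (UNIV :: 'a set)"
    and UN_lesspoll_universe:
      "(I :: 'a set) \<prec> (UNIV :: 'a set) \<Longrightarrow> (\<And>i. i \<in> I \<Longrightarrow> (A i :: 'a set) \<prec> (UNIV :: 'a set))
        \<Longrightarrow> (\<Union>i\<in>I. A i) \<prec> (UNIV :: 'a set)"

definition small :: "'u::set_universe set \<Rightarrow> bool" where
  "small A \<longleftrightarrow> A \<prec> (UNIV :: 'u set)"


section \<open>Normed categories and functors\<close>

text \<open>
  Hom-sets are indexed by pairs of objects, as for enriched categories, and need not be
  disjoint; hence norms, identities and composition also take the objects as arguments.
  \<open>cmp C x y z g f\<close> is the composite of \<open>f : x \<rightarrow> y\<close> followed by \<open>g : y \<rightarrow> z\<close>.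
\<close>

record ('o, 'm, 'v) ncat =
  Obj :: "'o set"
  Hom :: "'o \<Rightarrow> 'o \<Rightarrow> 'm set"
  nrm :: "'o \<Rightarrow> 'o \<Rightarrow> 'm \<Rightarrow> 'v"
  idn :: "'o \<Rightarrow> 'm"
  cmp :: "'o \<Rightarrow> 'o \<Rightarrow> 'o \<Rightarrow> 'm \<Rightarrow> 'm \<Rightarrow> 'm"

definition normed_category :: "('o, 'm, 'v::comm_quantale) ncat \<Rightarrow> bool" where
  "normed_category C \<longleftrightarrow>
    (\<forall>x\<in>Obj C. idn C x \<in> Hom C x x \<and> 1 \<le> nrm C x x (idn C x)) \<and>
    (\<forall>x\<in>Obj C. \<forall>y\<in>Obj C. \<forall>z\<in>Obj C. \<forall>f\<in>Hom C x y. \<forall>g\<in>Hom C y z.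
        cmp C x y z g f \<in> Hom C x z \<and>
        nrm C x y f * nrm C y z g \<le> nrm C x z (cmp C x y z g f)) \<and>
    (\<forall>x\<in>Obj C. \<forall>y\<in>Obj C. \<forall>f\<in>Hom C x y.
        cmp C x x y f (idn C x) = f \<and> cmp C x y y (idn C y) f = f) \<and>
    (\<forall>w\<in>Obj C. \<forall>x\<in>Obj C. \<forall>y\<in>Obj C. \<forall>z\<in>Obj C.
        \<forall>f\<in>Hom C w x. \<forall>g\<in>Hom C x y. \<forall>h\<in>Hom C y z.
        cmp C w x z (cmp C x y z h g) f = cmp C w y z h (cmp C w x y g f))"

definition locally_small :: "('o, 'u::set_universe, 'v) ncat \<Rightarrow> bool" where
  "locally_small C \<longleftrightarrow> (\<forall>x\<in>Obj C. \<forall>y\<in>Obj C. small (Hom C x y))"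

definition dual :: "('o, 'm, 'v) ncat \<Rightarrow> ('o, 'm, 'v) ncat" where
  "dual C = \<lparr>Obj = Obj C, Hom = (\<lambda>x y. Hom C y x), nrm = (\<lambda>x y. nrm C y x), idn = idn C,
     cmp = (\<lambda>x y z g f. cmp C z y x f g)\<rparr>"

record ('o, 'm, 'p, 'n) nfunctor =
  fob :: "'o \<Rightarrow> 'p"
  far :: "'o \<Rightarrow> 'o \<Rightarrow> 'm \<Rightarrow> 'n"

definition normed_functor ::
  "('o, 'm, 'v::comm_quantale) ncat \<Rightarrow> ('p, 'n, 'v) ncat \<Rightarrow> ('o, 'm, 'p, 'n) nfunctor \<Rightarrow> bool" where
  "normed_functor C D F \<longleftrightarrow>
    (\<forall>x\<in>Obj C. fob F x \<in> Obj D \<and> far F x x (idn C x) = idn D (fob F x)) \<and>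
    (\<forall>x\<in>Obj C. \<forall>y\<in>Obj C. \<forall>f\<in>Hom C x y.
        far F x y f \<in> Hom D (fob F x) (fob F y) \<and>
        nrm C x y f \<le> nrm D (fob F x) (fob F y) (far F x y f)) \<and>
    (\<forall>x\<in>Obj C. \<forall>y\<in>Obj C. \<forall>z\<in>Obj C. \<forall>f\<in>Hom C x y. \<forall>g\<in>Hom C y z.
        far F x z (cmp C x y z g f)
          = cmp D (fob F x) (fob F y) (fob F z) (far F y z g) (far F x y f))"

definition id_functor :: "('o, 'm, 'o, 'm) nfunctor" where
  "id_functor = \<lparr>fob = (\<lambda>x. x), far = (\<lambda>x y f. f)\<rparr>"

definition comp_functor ::
  "('p, 'n, 'q, 'l) nfunctor \<Rightarrow> ('o, 'm, 'p, 'n) nfunctor \<Rightarrow> ('o, 'm, 'q, 'l) nfunctor" where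
  "comp_functor G F = \<lparr>fob = (\<lambda>x. fob G (fob F x)),
     far = (\<lambda>x y f. far G (fob F x) (fob F y) (far F x y f))\<rparr>"


section \<open>Normed sets\<close>

record ('a, 'v) nset =
  elems :: "'a set"
  enorm :: "'a \<Rightarrow> 'v"

definition map_norm ::
  "('a, 'v::comm_quantale) nset \<Rightarrow> ('b, 'v) nset \<Rightarrow> ('a \<Rightarrow> 'b) \<Rightarrow> 'v" where
  "map_norm A B f = (INF a\<in>elems A. residual (enorm A a) (enorm B (f a)))"

text \<open>\<open>SetV\<close> is the category \<open>Set||V\<close> of small normed sets and arbitrary maps.\<close>

definition SetV :: "(('u::set_universe, 'v::comm_quantale) nset, 'u \<Rightarrow> 'u, 'v) ncat" where
  "SetV = \<lparr>Obj = {A. small (elems A)},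
     Hom = (\<lambda>A B. elems A \<rightarrow>\<^sub>E elems B),
     nrm = map_norm,
     idn = (\<lambda>A. restrict (\<lambda>a. a) (elems A)),
     cmp = (\<lambda>A B C g f. compose (elems A) g f)\<rparr>"


section \<open>Presheaves\<close>

text \<open>
  Presheaves on \<open>C\<close> are normed functors from \<open>dual C\<close> to \<open>SetV\<close>; for \<open>f : y \<rightarrow> x\<close> in \<open>C\<close>
  the map from \<open>P x\<close> to \<open>P y\<close> is \<open>far P x y f\<close>.  The element types of \<open>P\<close> and \<open>Q\<close> in
  \<open>nat_trans C P Q\<close> may differ, so that \<open>Q\<close> may be a hom-functor of a category which is not
  locally small.
\<close>

type_synonym ('o, 'm, 'a, 'v) presheaf = "('o, 'm, ('a, 'v) nset, 'a \<Rightarrow> 'a) nfunctor"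

definition nat_trans ::
  "('o, 'm, 'v) ncat \<Rightarrow> ('o, 'm, 'a, 'v) presheaf \<Rightarrow> ('o, 'm, 'b, 'v) presheaf
    \<Rightarrow> ('o \<Rightarrow> 'a \<Rightarrow> 'b) set" where
  "nat_trans C P Q = {\<alpha> \<in> (\<Pi>\<^sub>E x\<in>Obj C. elems (fob P x) \<rightarrow>\<^sub>E elems (fob Q x)).
     \<forall>x\<in>Obj C. \<forall>y\<in>Obj C. \<forall>f\<in>Hom C y x. \<forall>a\<in>elems (fob P x).
       \<alpha> y (far P x y f a) = far Q x y f (\<alpha> x a)}"

definition nat_norm ::
  "('o, 'm, 'v::comm_quantale) ncat \<Rightarrow> ('o, 'm, 'a, 'v) presheaf \<Rightarrow> ('o, 'm, 'b, 'v) presheaf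
    \<Rightarrow> ('o \<Rightarrow> 'a \<Rightarrow> 'b) \<Rightarrow> 'v" where
  "nat_norm C P Q \<alpha> = (INF x\<in>Obj C. map_norm (fob P x) (fob Q x) (\<alpha> x))"

definition presheaf_cat ::
  "('o, 'm, 'v::comm_quantale) ncat
    \<Rightarrow> (('o, 'm, 'u::set_universe, 'v) presheaf, 'o \<Rightarrow> 'u \<Rightarrow> 'u, 'v) ncat" where
  "presheaf_cat C = \<lparr>Obj = {P. normed_functor (dual C) SetV P},
     Hom = nat_trans C,
     nrm = nat_norm C,
     idn = (\<lambda>P. \<lambda>x\<in>Obj C. restrict (\<lambda>a. a) (elems (fob P x))),
     cmp = (\<lambda>P Q R \<beta> \<alpha>. \<lambda>x\<in>Obj C. compose (elems (fob P x)) (\<beta> x) (\<alpha> x))\<rparr>"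

text \<open>\<open>hom_presheaf D F y\<close> is the functor \<open>D(F-, y)\<close> on the dual of the domain category of \<open>F\<close>.\<close>

definition hom_presheaf ::
  "('p, 'n, 'v) ncat \<Rightarrow> ('o, 'm, 'p, 'n) nfunctor \<Rightarrow> 'p \<Rightarrow> ('o, 'm, 'n, 'v) presheaf" where
  "hom_presheaf D F y = \<lparr>fob = (\<lambda>a. \<lparr>elems = Hom D (fob F a) y, enorm = nrm D (fob F a) y\<rparr>),
     far = (\<lambda>a b f. \<lambda>g\<in>Hom D (fob F a) y. cmp D (fob F b) (fob F a) y g (far F b a f))\<rparr>"

definition yoneda ::
  "('o, 'u::set_universe, 'v) ncat
    \<Rightarrow> ('o, 'u, ('o, 'u, 'u, 'v) presheaf, 'o \<Rightarrow> 'u \<Rightarrow> 'u) nfunctor" where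
  "yoneda C = \<lparr>fob = hom_presheaf C id_functor,
     far = (\<lambda>x y h. \<lambda>a\<in>Obj C. \<lambda>g\<in>Hom C a x. cmp C a x y h g)\<rparr>"


section \<open>Weighted colimits and accessible presheaves\<close>

text \<open>
  \<open>weighted_colimit A D J F c \<theta>\<close>: the object \<open>c\<close> of \<open>D\<close> is the colimit of \<open>F : A \<rightarrow> D\<close> weighted
  by the presheaf \<open>J\<close> on \<open>A\<close>, with isomorphisms \<open>\<theta> y : D(c,y) \<cong> Nat(J, D(F-,y))\<close> natural in \<open>y\<close>.
\<close>

definition weighted_colimit ::
  "('o, 'm, 'v::comm_quantale) ncat \<Rightarrow> ('p, 'n, 'v) ncat \<Rightarrow> ('o, 'm, 'a, 'v) presheaf
    \<Rightarrow> ('o, 'm, 'p, 'n) nfunctor \<Rightarrow> 'p \<Rightarrow> ('p \<Rightarrow> 'n \<Rightarrow> 'o \<Rightarrow> 'a \<Rightarrow> 'n) \<Rightarrow> bool" where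
  "weighted_colimit A D J F c \<theta> \<longleftrightarrow>
    c \<in> Obj D \<and>
    (\<forall>y\<in>Obj D. bij_betw (\<theta> y) (Hom D c y) (nat_trans A J (hom_presheaf D F y))) \<and>
    (\<forall>y\<in>Obj D. \<forall>f\<in>Hom D c y. nat_norm A J (hom_presheaf D F y) (\<theta> y f) = nrm D c y f) \<and>
    (\<forall>y\<in>Obj D. \<forall>z\<in>Obj D. \<forall>f\<in>Hom D c y. \<forall>h\<in>Hom D y z. \<forall>a\<in>Obj A. \<forall>t\<in>elems (fob J a).
        \<theta> z (cmp D c y z h f) a t = cmp D (fob F a) y z h (\<theta> y f a t))"

text \<open>
  Accessible presheaves are the small-weighted colimits of representables.  Up to isomorphism,
  the objects of a small category can be taken from \<open>'u\<close> as well.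
\<close>

definition accessible ::
  "('o, 'u::set_universe, 'v::comm_quantale) ncat \<Rightarrow> ('o, 'u, 'u, 'v) presheaf \<Rightarrow> bool" where
  "accessible C P \<longleftrightarrow>
    (\<exists>(A :: ('u, 'u, 'v) ncat) (F :: ('u, 'u, 'o, 'u) nfunctor) (J :: ('u, 'u, 'u, 'v) presheaf) \<theta>.
      normed_category A \<and> small (Obj A) \<and> locally_small A \<and>
      normed_functor A C F \<and> normed_functor (dual A) SetV J \<and>
      weighted_colimit A (presheaf_cat C) J (comp_functor (yoneda C) F) P \<theta>)"

definition accessible_presheaf_cat ::
  "('o, 'u::set_universe, 'v::comm_quantale) ncat
    \<Rightarrow> (('o, 'u, 'u, 'v) presheaf, 'o \<Rightarrow> 'u \<Rightarrow> 'u, 'v) ncat" where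
  "accessible_presheaf_cat C =
    presheaf_cat C \<lparr>Obj := {P \<in> Obj (presheaf_cat C). accessible C P}\<rparr>"


section \<open>Sequences and normed colimits\<close>

record ('o, 'm) nseq =
  pt :: "nat \<Rightarrow> 'o"
  tr :: "nat \<Rightarrow> nat \<Rightarrow> 'm"

definition sequence_in :: "('o, 'm, 'v) ncat \<Rightarrow> ('o, 'm) nseq \<Rightarrow> bool" where
  "sequence_in C s \<longleftrightarrow>
    (\<forall>n. pt s n \<in> Obj C \<and> tr s n n = idn C (pt s n)) \<and>
    (\<forall>m n. m \<le> n \<longrightarrow> tr s m n \<in> Hom C (pt s m) (pt s n)) \<and>
    (\<forall>l m n. l \<le> m \<longrightarrow> m \<le> n \<longrightarrow>
        tr s l n = cmp C (pt s l) (pt s m) (pt s n) (tr s m n) (tr s l m))"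

definition Cauchy_sequence :: "('o, 'm, 'v::comm_quantale) ncat \<Rightarrow> ('o, 'm) nseq \<Rightarrow> bool" where
  "Cauchy_sequence C s \<longleftrightarrow> sequence_in C s \<and>
    1 \<le> (SUP N. INF (m, n)\<in>{(m, n). N \<le> m \<and> m \<le> n}. nrm C (pt s m) (pt s n) (tr s m n))"

definition map_seq :: "('o, 'm, 'p, 'n) nfunctor \<Rightarrow> ('o, 'm) nseq \<Rightarrow> ('p, 'n) nseq" where
  "map_seq F s = \<lparr>pt = (\<lambda>n. fob F (pt s n)), tr = (\<lambda>m n. far F (pt s m) (pt s n) (tr s m n))\<rparr>"

definition cocone :: "('o, 'm, 'v) ncat \<Rightarrow> ('o, 'm) nseq \<Rightarrow> 'o \<Rightarrow> (nat \<Rightarrow> 'm) \<Rightarrow> bool" where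
  "cocone C s x \<gamma> \<longleftrightarrow> x \<in> Obj C \<and> (\<forall>n. \<gamma> n \<in> Hom C (pt s n) x) \<and>
    (\<forall>m n. m \<le> n \<longrightarrow> cmp C (pt s m) (pt s n) x (\<gamma> n) (tr s m n) = \<gamma> m)"

definition normed_colimit ::
  "('o, 'm, 'v::comm_quantale) ncat \<Rightarrow> ('o, 'm) nseq \<Rightarrow> 'o \<Rightarrow> (nat \<Rightarrow> 'm) \<Rightarrow> bool" where
  "normed_colimit C s x \<gamma> \<longleftrightarrow>
    cocone C s x \<gamma> \<and>
    (\<forall>y \<delta>. cocone C s y \<delta> \<longrightarrow> (\<exists>!f. f \<in> Hom C x y \<and> (\<forall>n. cmp C (pt s n) x y f (\<gamma> n) = \<delta> n))) \<and>
    (\<forall>y\<in>Obj C. \<forall>f\<in>Hom C x y.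
        nrm C x y f = (SUP N. INF n\<in>{N..}. nrm C (pt s n) y (cmp C (pt s n) x y f (\<gamma> n))))"

end

theory Submission
  imports Defs
begin

text \<open>
  By the Yoneda lemma, a cocone from \<open>yoneda X \<cdot> s\<close> to a representable \<open>X(-,y)\<close> is the same as
  a cocone \<open>\<delta>\<close> from \<open>s\<close> to \<open>y\<close>, norms included.  As representables are accessible, the universal
  property of \<open>\<phi>\<close> may be tested against them: \<open>Nat(\<phi>, X(-,y))\<close> is in bijection with the cocones
  from \<open>s\<close> to \<open>y\<close>, naturally in \<open>y\<close>, and the norm of a transformation is
  \<open>\<Squnion>\<^sub>N \<Sqinter>\<^sub>n\<^sub>\<ge>\<^sub>N |\<delta>\<^sub>n|\<close>.  Hence an isomorphism \<open>X(x,-) \<cong> Nat(\<phi>, X(-,-))\<close> is the same as an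
  isomorphism of \<open>X(x,-)\<close> with the normed set of cocones, that is, a normed colimit of \<open>s\<close>.
\<close>

section \<open>Residuation in a quantale and auxiliary facts\<close>

lemma quantale_mult_right_mono:
  fixes a b c :: "'v::comm_quantale"
  assumes "a \<le> b"
  shows "a * c \<le> b * c"
proof -
  \<comment> \<open>Monotonicity is read off from preservation of the join of \<open>{a, b}\<close>,
    which equals \<open>b\<close>.\<close>
  have "b * c = Sup {a, b} * c"
    using assms by (simp add: sup.absorb2)
  also have "\<dots> = sup (a * c) (b * c)"
    unfolding Sup_mult_distrib by simp
  finally show ?thesis
    by (metis sup.cobounded1)
qed

text \<open>Since \<open>- * v\<close> preserves joins, the supremum defining
  \<open>residual v w\<close> satisfies the very inequality it ranges over; this makes it a right
  adjoint.\<close>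

lemma le_residual_iff: "u \<le> residual v w \<longleftrightarrow> u * v \<le> (w::'v::comm_quantale)"
proof
  assume "u \<le> residual v w"
  then have "u * v \<le> residual v w * v"
    by (rule quantale_mult_right_mono)
  also have "\<dots> \<le> w"
    unfolding residual_def Sup_mult_distrib by (rule SUP_least) simp
  finally show "u * v \<le> w" .
qed (simp add: residual_def Sup_upper)

lemma residual_one: "residual 1 w = (w::'v::comm_quantale)"
  by (rule order.antisym) (use le_residual_iff[of _ 1 w] in auto)

text \<open>Multiplying by an element above the unit can only enlarge. The case used below takes for
  \<open>v\<close> the norm of an identity.\<close>

lemma residual_le:
  assumes "1 \<le> (v::'v::comm_quantale)"
  shows "residual v w \<le> w"
proof -
  have "residual v w * 1 \<le> residual v w * v"
    using quantale_mult_right_mono[OF assms, of "residual v w"] by (simp add: mult.commute)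
  also have "\<dots> \<le> w"
    using le_residual_iff by blast
  finally show ?thesis by simp
qed

text \<open>Links the unique-existence form of universal properties to the bijections in which
  weighted colimits are phrased.\<close>

lemma bij_betw_iff_ex1:
  "bij_betw f A B \<longleftrightarrow> (\<forall>a\<in>A. f a \<in> B) \<and> (\<forall>b\<in>B. \<exists>!a. a \<in> A \<and> f a = b)"
proof
  assume "bij_betw f A B"
  then show "(\<forall>a\<in>A. f a \<in> B) \<and> (\<forall>b\<in>B. \<exists>!a. a \<in> A \<and> f a = b)"
    by (auto simp: bij_betw_def dest: inj_onD)
next
  assume *: "(\<forall>a\<in>A. f a \<in> B) \<and> (\<forall>b\<in>B. \<exists>!a. a \<in> A \<and> f a = b)"
  show "bij_betw f A B"
    unfolding bij_betw_def
  proof (intro conjI inj_onI subset_antisym subsetI)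
    show "a = b" if "a \<in> A" "b \<in> A" "f a = f b" for a b
      using * that by metis
    show "b \<in> f ` A" if "b \<in> B" for b
      using * that by blast
  qed (use * in auto)
qed

lemma small_singleton: "small {u :: 'u::set_universe}"
  unfolding small_def
proof (rule finite_lesspoll_infinite)
  show "infinite (UNIV :: 'u set)"
    using nat_lesspoll_universe[where 'a = 'u] lesspoll_imp_lepoll
    by (metis infinite_le_lepoll)
qed simp

lemma fob_hom_presheaf:
    "fob (hom_presheaf D F y) a = \<lparr>elems = Hom D (fob F a) y, enorm = nrm D (fob F a) y\<rparr>"
  and far_hom_presheaf:
    "far (hom_presheaf D F y) a b f
      = (\<lambda>g\<in>Hom D (fob F a) y. cmp D (fob F b) (fob F a) y g (far F b a f))"
  by (simp_all add: hom_presheaf_def)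

lemma presheaf_cat_sel:
  "Hom (presheaf_cat C) = nat_trans C"
  "nrm (presheaf_cat C) = nat_norm C"
  by (simp_all add: presheaf_cat_def)

section \<open>The Yoneda lemma with norms\<close>

context
  fixes X :: "('o, 'u::set_universe, 'v::comm_quantale) ncat"
  assumes X: "normed_category X" and X_small: "locally_small X"
begin

lemma idn_in [simp]: "x \<in> Obj X \<Longrightarrow> idn X x \<in> Hom X x x"
  and one_le_nrm_idn: "x \<in> Obj X \<Longrightarrow> 1 \<le> nrm X x x (idn X x)"
  and cmp_in [simp]: "\<lbrakk>x \<in> Obj X; y \<in> Obj X; z \<in> Obj X; f \<in> Hom X x y; g \<in> Hom X y z\<rbrakk>
    \<Longrightarrow> cmp X x y z g f \<in> Hom X x z"
  and nrm_cmp: "\<lbrakk>x \<in> Obj X; y \<in> Obj X; z \<in> Obj X; f \<in> Hom X x y; g \<in> Hom X y z\<rbrakk>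
    \<Longrightarrow> nrm X x y f * nrm X y z g \<le> nrm X x z (cmp X x y z g f)"
  and cmp_idn [simp]: "\<lbrakk>x \<in> Obj X; y \<in> Obj X; f \<in> Hom X x y\<rbrakk> \<Longrightarrow> cmp X x x y f (idn X x) = f"
  and idn_cmp [simp]: "\<lbrakk>x \<in> Obj X; y \<in> Obj X; f \<in> Hom X x y\<rbrakk> \<Longrightarrow> cmp X x y y (idn X y) f = f"
  and cmp_assoc: "\<lbrakk>w \<in> Obj X; x \<in> Obj X; y \<in> Obj X; z \<in> Obj X;
      f \<in> Hom X w x; g \<in> Hom X x y; h \<in> Hom X y z\<rbrakk>
    \<Longrightarrow> cmp X w x z (cmp X x y z h g) f = cmp X w y z h (cmp X w x y g f)"
  using X unfolding normed_category_def by simp_all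

abbreviation rep :: "'o \<Rightarrow> ('o, 'u, 'u, 'v) presheaf" where
  "rep \<equiv> hom_presheaf X id_functor"

lemma elems_rep [simp]: "elems (fob (rep y) a) = Hom X a y"
  and enorm_rep [simp]: "enorm (fob (rep y) a) = nrm X a y"
  and far_rep: "far (rep y) a b f = (\<lambda>g\<in>Hom X a y. cmp X b a y g f)"
  by (simp_all add: fob_hom_presheaf far_hom_presheaf id_functor_def)

lemma fob_yoneda [simp]: "fob (yoneda X) y = rep y"
  by (simp add: yoneda_def)

text \<open>By residuation, the norm condition on the restriction maps is the norm inequality for
  composites in \<open>X\<close>. Local smallness makes the values objects of
  \<open>SetV\<close>.\<close>

lemma rep_in_presheaf_cat:
  assumes y: "y \<in> Obj X"
  shows "rep y \<in> Obj (presheaf_cat X)"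
proof -
  have "nrm X b a f \<le> map_norm (fob (rep y) a) (fob (rep y) b) (far (rep y) a b f)"
    if "a \<in> Obj X" "b \<in> Obj X" "f \<in> Hom X b a" for a b f
    unfolding map_norm_def
    by (rule INF_greatest) (use that y in \<open>simp add: le_residual_iff far_rep nrm_cmp\<close>)
  then show ?thesis
    using y X_small
    by (auto simp: presheaf_cat_def normed_functor_def dual_def SetV_def locally_small_def
        far_rep compose_def restrict_def PiE_def Pi_def extensional_def cmp_assoc fun_eq_iff)
qed

lemma yoneda_arrow_in_nat_trans:
  assumes "x \<in> Obj X" "y \<in> Obj X" "f \<in> Hom X x y"
  shows "far (yoneda X) x y f \<in> nat_trans X (rep x) (rep y)"
  using assms
  by (auto simp: yoneda_def nat_trans_def far_rep cmp_assoc intro!: PiE_I)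

lemma nat_transD:
  assumes "\<alpha> \<in> nat_trans X P Q" "x \<in> Obj X"
  shows "\<alpha> x \<in> elems (fob P x) \<rightarrow>\<^sub>E elems (fob Q x)"
    and "\<And>a. a \<in> elems (fob P x) \<Longrightarrow> \<alpha> x a \<in> elems (fob Q x)"
    and "\<And>y f a. \<lbrakk>y \<in> Obj X; f \<in> Hom X y x; a \<in> elems (fob P x)\<rbrakk>
      \<Longrightarrow> \<alpha> y (far P x y f a) = far Q x y f (\<alpha> x a)"
  using assms unfolding nat_trans_def by (auto dest: PiE_mem)

lemma nat_transI:
  assumes "\<And>x. x \<notin> Obj X \<Longrightarrow> \<alpha> x = undefined"
    and "\<And>x a. \<lbrakk>x \<in> Obj X; a \<notin> elems (fob P x)\<rbrakk> \<Longrightarrow> \<alpha> x a = undefined"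
    and "\<And>x a. \<lbrakk>x \<in> Obj X; a \<in> elems (fob P x)\<rbrakk> \<Longrightarrow> \<alpha> x a \<in> elems (fob Q x)"
    and "\<And>x y f a. \<lbrakk>x \<in> Obj X; y \<in> Obj X; f \<in> Hom X y x; a \<in> elems (fob P x)\<rbrakk>
      \<Longrightarrow> \<alpha> y (far P x y f a) = far Q x y f (\<alpha> x a)"
  shows "\<alpha> \<in> nat_trans X P Q"
  unfolding nat_trans_def mem_Collect_eq
  by (intro conjI ballI PiE_I) (rule assms; assumption)+

text \<open>Both layers of a transformation are extensional functions, so nothing outside the
  presheaf \<open>P\<close> has to be compared.\<close>

lemma nat_trans_eqI:
  assumes "\<alpha> \<in> nat_trans X P Q" "\<beta> \<in> nat_trans X P Q"
    and "\<And>x a. \<lbrakk>x \<in> Obj X; a \<in> elems (fob P x)\<rbrakk> \<Longrightarrow> \<alpha> x a = \<beta> x a"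
  shows "\<alpha> = \<beta>"
proof (rule PiE_ext)
  show "\<alpha> \<in> (\<Pi>\<^sub>E x\<in>Obj X. elems (fob P x) \<rightarrow>\<^sub>E elems (fob Q x))"
    "\<beta> \<in> (\<Pi>\<^sub>E x\<in>Obj X. elems (fob P x) \<rightarrow>\<^sub>E elems (fob Q x))"
    using assms(1,2) by (auto simp: nat_trans_def)
  show "\<alpha> x = \<beta> x" if "x \<in> Obj X" for x
    using nat_transD(1)[OF assms(1) that] nat_transD(1)[OF assms(2) that] assms(3)[OF that]
    by (rule PiE_ext)
qed

text \<open>Each \<open>g\<close> in \<open>Hom X a x\<close> is the restriction along
  \<open>g\<close> of the identity of \<open>x\<close>, so naturality determines
  \<open>\<alpha> a g\<close> from the value at that identity: the embedding is full.\<close>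

lemma yoneda_expand:
  assumes "x \<in> Obj X" "y \<in> Obj X" "\<alpha> \<in> nat_trans X (rep x) (rep y)"
  shows "\<alpha> x (idn X x) \<in> Hom X x y"
    and "\<alpha> = far (yoneda X) x y (\<alpha> x (idn X x))"
proof -
  show e: "\<alpha> x (idn X x) \<in> Hom X x y"
    using nat_transD(2)[OF assms(3,1)] assms by simp
  show "\<alpha> = far (yoneda X) x y (\<alpha> x (idn X x))"
  proof (rule nat_trans_eqI[OF assms(3) yoneda_arrow_in_nat_trans[OF assms(1,2) e]])
    fix a g assume a: "a \<in> Obj X" and g: "g \<in> elems (fob (rep x) a)"
    have "\<alpha> a g = \<alpha> a (far (rep x) x a g (idn X x))"
      using a g assms by (simp add: far_rep)
    also have "\<dots> = far (rep y) x a g (\<alpha> x (idn X x))"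
      using nat_transD(3)[OF assms(3,1)] a g assms by simp
    also have "\<dots> = far (yoneda X) x y (\<alpha> x (idn X x)) a g"
      using a g e by (simp add: far_rep yoneda_def)
    finally show "\<alpha> a g = far (yoneda X) x y (\<alpha> x (idn X x)) a g" .
  qed
qed

text \<open>Evaluation at the identity, whose norm is above the unit, bounds the infimum from above;
  the norm inequality for composites bounds every component from below.\<close>

lemma yoneda_norm:
  assumes x: "x \<in> Obj X" and y: "y \<in> Obj X" and f: "f \<in> Hom X x y"
  shows "nat_norm X (rep x) (rep y) (far (yoneda X) x y f) = nrm X x y f"
proof (rule order.antisym)
  have "nat_norm X (rep x) (rep y) (far (yoneda X) x y f)
      \<le> map_norm (fob (rep x) x) (fob (rep y) x) (far (yoneda X) x y f x)"
    unfolding nat_norm_def using x by (rule INF_lower)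
  also have "\<dots> \<le> residual (nrm X x x (idn X x)) (nrm X x y (far (yoneda X) x y f x (idn X x)))"
    unfolding map_norm_def using x by (intro INF_lower2[where i = "idn X x"]) auto
  also have "\<dots> \<le> nrm X x y f"
    using residual_le[OF one_le_nrm_idn[OF x]] x y f by (simp add: yoneda_def)
  finally show "nat_norm X (rep x) (rep y) (far (yoneda X) x y f) \<le> nrm X x y f" .
  have "nrm X x y f * nrm X a x g \<le> nrm X a y (cmp X a x y f g)"
    if "a \<in> Obj X" "g \<in> Hom X a x" for a g
    using nrm_cmp[of a x y g f] that x y f by (simp add: mult.commute)
  then show "nrm X x y f \<le> nat_norm X (rep x) (rep y) (far (yoneda X) x y f)"
    unfolding nat_norm_def map_norm_def
    by (intro INF_greatest) (simp add: le_residual_iff yoneda_def)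
qed

section \<open>Accessibility of representables\<close>

text \<open>Serves to show that the arrow of a one-object category acts trivially on transformations
  out of \<open>rep y\<close>. The equality is strict because \<open>\<alpha>\<close> and the
  composite are both extensional.\<close>

lemma nat_trans_cmp_idn:
  assumes y: "y \<in> Obj X" and \<alpha>: "\<alpha> \<in> nat_trans X (rep y) Q"
  shows "cmp (presheaf_cat X) (rep y) (rep y) Q \<alpha> (far (yoneda X) y y (idn X y)) = \<alpha>"
proof (rule PiE_ext)
  show "\<alpha> \<in> (\<Pi>\<^sub>E x\<in>Obj X. elems (fob (rep y) x) \<rightarrow>\<^sub>E elems (fob Q x))"
    using \<alpha> by (simp add: nat_trans_def)
  show "cmp (presheaf_cat X) (rep y) (rep y) Q \<alpha> (far (yoneda X) y y (idn X y)) x = \<alpha> x"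
    if "x \<in> Obj X" for x
    using that y nat_transD(1)[OF \<alpha> that]
    by (auto simp: presheaf_cat_def yoneda_def compose_def fun_eq_iff PiE_def extensional_def)
  then show "cmp (presheaf_cat X) (rep y) (rep y) Q \<alpha> (far (yoneda X) y y (idn X y))
      \<in> (\<Pi>\<^sub>E x\<in>Obj X. elems (fob (rep y) x) \<rightarrow>\<^sub>E elems (fob Q x))"
    using nat_transD(1)[OF \<alpha>] by (auto simp: presheaf_cat_def)
qed

text \<open>A representable is its own colimit, weighted by the unit over the one-object category.\<close>

lemma rep_accessible:
  assumes y: "y \<in> Obj X"
  shows "accessible X (rep y)"
proof -
  \<comment> \<open>An arbitrary element, serving as the only object, the only arrow and the only
    point of the weight.\<close>
  define u :: 'u where "u = undefined"
  define A :: "('u, 'u, 'v) ncat" where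
    "A = \<lparr>Obj = {u}, Hom = (\<lambda>_ _. {u}), nrm = (\<lambda>_ _ _. 1), idn = (\<lambda>_. u),
       cmp = (\<lambda>_ _ _ _ _. u)\<rparr>"
  define F :: "('u, 'u, 'o, 'u) nfunctor" where
    "F = \<lparr>fob = (\<lambda>_. y), far = (\<lambda>_ _ _. idn X y)\<rparr>"
  define J :: "('u, 'u, 'u, 'v) presheaf" where
    "J = \<lparr>fob = (\<lambda>_. \<lparr>elems = {u}, enorm = (\<lambda>_. 1)\<rparr>), far = (\<lambda>_ _ _. \<lambda>t\<in>{u}. t)\<rparr>"
  \<comment> \<open>A transformation out of the unit weight picks one element of the hom-object, so
    \<open>\<theta> Q\<close> wraps \<open>\<alpha>\<close> as a constant family; the restrictions
    keep it extensional.\<close>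
  define \<theta> :: "('o, 'u, 'u, 'v) presheaf \<Rightarrow> ('o \<Rightarrow> 'u \<Rightarrow> 'u) \<Rightarrow> 'u \<Rightarrow> 'u \<Rightarrow> 'o \<Rightarrow> 'u \<Rightarrow> 'u"
    where "\<theta> = (\<lambda>Q \<alpha>. \<lambda>a\<in>{u}. \<lambda>t\<in>{u}. \<alpha>)"
  let ?D = "presheaf_cat X" and ?YF = "comp_functor (yoneda X) F"
  have hom: "elems (fob (hom_presheaf ?D ?YF Q) a) = nat_trans X (rep y) Q"
    "enorm (fob (hom_presheaf ?D ?YF Q) a) = nat_norm X (rep y) Q"
    "far (hom_presheaf ?D ?YF Q) a b f = (\<lambda>\<alpha>\<in>nat_trans X (rep y) Q. \<alpha>)" for Q a b f
    unfolding fob_hom_presheaf far_hom_presheaf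
    by (simp_all add: comp_functor_def F_def nat_trans_cmp_idn[OF y] presheaf_cat_sel
        cong: restrict_cong)
  \<comment> \<open>The arrow of \<open>A\<close> acts as the identity on both sides, so naturality
    is automatic and only the typing condition remains.\<close>
  have nt: "nat_trans A J (hom_presheaf ?D ?YF Q)
      = (\<Pi>\<^sub>E a\<in>{u}. {u} \<rightarrow>\<^sub>E nat_trans X (rep y) Q)" for Q
  proof -
    have "\<beta> u u \<in> nat_trans X (rep y) Q" if "\<beta> \<in> (\<Pi>\<^sub>E a\<in>{u}. {u} \<rightarrow>\<^sub>E nat_trans X (rep y) Q)" for \<beta>
      using PiE_mem[OF PiE_mem[OF that]] by simp
    then show ?thesis
      unfolding nat_trans_def[of A] hom
      by (intro subset_antisym subsetI) (simp_all add: A_def J_def)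
  qed
  have bij: "bij_betw (\<theta> Q) (nat_trans X (rep y) Q) (nat_trans A J (hom_presheaf ?D ?YF Q))"
    for Q
    unfolding nt
    by (rule bij_betw_byWitness[where f' = "\<lambda>\<beta>. \<beta> u u"])
      (auto simp: \<theta>_def fun_eq_iff restrict_def PiE_def extensional_def)
  have "weighted_colimit A ?D J ?YF (rep y) \<theta>"
    unfolding weighted_colimit_def
  proof (intro conjI ballI)
    show "rep y \<in> Obj ?D" by (rule rep_in_presheaf_cat[OF y])
    show "bij_betw (\<theta> Q) (Hom ?D (rep y) Q) (nat_trans A J (hom_presheaf ?D ?YF Q))" for Q
      using bij by (simp add: presheaf_cat_sel)
    \<comment> \<open>The point of the weight has norm \<open>1\<close> and
      \<open>residual 1 w = w\<close>, so the infimum over this single point returns the norm of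
      \<open>f\<close>.\<close>
    show "nat_norm A J (hom_presheaf ?D ?YF Q) (\<theta> Q f) = nrm ?D (rep y) Q f" for Q f
      unfolding nat_norm_def[of A] map_norm_def hom
      by (simp add: A_def J_def residual_one \<theta>_def presheaf_cat_sel)
    show "\<theta> R (cmp ?D (rep y) Q R h f) a t = cmp ?D (fob ?YF a) Q R h (\<theta> Q f a t)"
      if "a \<in> Obj A" "t \<in> elems (fob J a)" for Q R f h a t
      using that by (simp add: \<theta>_def A_def J_def comp_functor_def F_def)
  qed
  moreover have "normed_category A" "small (Obj A)" "locally_small A"
    by (simp_all add: A_def normed_category_def locally_small_def small_singleton)
  moreover have "normed_functor A X F"
    using y by (simp add: normed_functor_def A_def F_def one_le_nrm_idn)
  moreover have "normed_functor (dual A) SetV J"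
    by (auto simp: normed_functor_def dual_def A_def J_def SetV_def small_singleton map_norm_def
        residual_one compose_def fun_eq_iff)
  ultimately show ?thesis
    unfolding accessible_def by blast
qed

lemma rep_in_accessible_presheaf_cat:
  "y \<in> Obj X \<Longrightarrow> rep y \<in> Obj (accessible_presheaf_cat X)"
  by (simp add: accessible_presheaf_cat_def rep_in_presheaf_cat rep_accessible)

lemma accessible_presheaf_cat_sel [simp]:
  "Hom (accessible_presheaf_cat X) = nat_trans X"
  "nrm (accessible_presheaf_cat X) = nat_norm X"
  "cmp (accessible_presheaf_cat X) = cmp (presheaf_cat X)"
  by (simp_all add: accessible_presheaf_cat_def presheaf_cat_sel)

section \<open>Composition of transformations and faithfulness of the Yoneda embedding\<close>

text \<open>Functoriality of \<open>P\<close> keeps \<open>far P x y f a\<close> inside the domain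
  on which the extensional composite is the pointwise one; naturality then passes through
  \<open>\<alpha>\<close> and \<open>\<beta>\<close> in turn.\<close>

lemma cmp_presheaf_cat_in_nat_trans:
  assumes P: "normed_functor (dual X) SetV P"
    and \<alpha>: "\<alpha> \<in> nat_trans X P Q" and \<beta>: "\<beta> \<in> nat_trans X Q R"
  shows "cmp (presheaf_cat X) P Q R \<beta> \<alpha> \<in> nat_trans X P R"
proof -
  have P_map: "far P x y f \<in> elems (fob P x) \<rightarrow>\<^sub>E elems (fob P y)"
    if "x \<in> Obj X" "y \<in> Obj X" "f \<in> Hom X y x" for x y f
    using P that by (simp add: normed_functor_def dual_def SetV_def)
  have P_in: "far P x y f a \<in> elems (fob P y)"
    if "x \<in> Obj X" "y \<in> Obj X" "f \<in> Hom X y x" "a \<in> elems (fob P x)" for x y f a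
    using PiE_mem[OF P_map[OF that(1-3)] that(4)] .
  let ?c = "cmp (presheaf_cat X) P Q R \<beta> \<alpha>"
  have c: "?c x a = \<beta> x (\<alpha> x a)" if "x \<in> Obj X" "a \<in> elems (fob P x)" for x a
    using that by (simp add: presheaf_cat_def compose_def)
  show ?thesis
  proof (rule nat_transI)
    show "?c x = undefined" if "x \<notin> Obj X" for x
      using that by (simp add: presheaf_cat_def)
    show "?c x a = undefined" if "x \<in> Obj X" "a \<notin> elems (fob P x)" for x a
      using that by (simp add: presheaf_cat_def compose_def)
    show "?c x a \<in> elems (fob R x)" if "x \<in> Obj X" "a \<in> elems (fob P x)" for x a
      using that by (simp add: c nat_transD(2)[OF \<alpha>] nat_transD(2)[OF \<beta>])
    show "?c y (far P x y f a) = far R x y f (?c x a)"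
      if "x \<in> Obj X" "y \<in> Obj X" "f \<in> Hom X y x" "a \<in> elems (fob P x)" for x y f a
      using that
      by (simp add: c P_in nat_transD(2)[OF \<alpha>] nat_transD(3)[OF \<alpha>] nat_transD(3)[OF \<beta>])
  qed
qed

lemma cmp_yoneda_arrows:
  assumes "x \<in> Obj X" "y \<in> Obj X" "z \<in> Obj X" "f \<in> Hom X x y" "g \<in> Hom X y z"
  shows "cmp (presheaf_cat X) (rep x) (rep y) (rep z) (far (yoneda X) y z g) (far (yoneda X) x y f)
    = far (yoneda X) x z (cmp X x y z g f)"
  using assms
  by (auto simp: presheaf_cat_def yoneda_def compose_def fun_eq_iff cmp_assoc restrict_def)

text \<open>Evaluation at the identity recovers the arrow: the embedding is faithful.\<close>

lemma yoneda_arrow_inj: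
  assumes "x \<in> Obj X" "y \<in> Obj X" "f \<in> Hom X x y" "g \<in> Hom X x y"
    and "far (yoneda X) x y f = far (yoneda X) x y g"
  shows "f = g"
proof -
  have "far (yoneda X) x y f x (idn X x) = far (yoneda X) x y g x (idn X x)"
    using assms by simp
  then show ?thesis using assms by (simp add: yoneda_def)
qed

section \<open>Cocones on the sequence and transformations out of \<open>\<phi>\<close>\<close>

context
  fixes s :: "('o, 'u) nseq"
    and \<phi> :: "('o, 'u, 'u, 'v) presheaf"
    and \<gamma> :: "nat \<Rightarrow> 'o \<Rightarrow> 'u \<Rightarrow> 'u"
  assumes s: "sequence_in X s"
    and \<phi>: "normed_colimit (accessible_presheaf_cat X) (map_seq (yoneda X) s) \<phi> \<gamma>"
begin

text \<open>By the Yoneda lemma \<open>\<gamma> n\<close> is a point of \<open>\<phi>\<close> at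
  \<open>pt s n\<close>, namely its value at the identity. The image of this point under
  \<open>\<alpha>\<close> is, for a representable target, the arrow representing the composite of
  \<open>\<alpha>\<close> with \<open>\<gamma> n\<close>.\<close>

definition transpose :: "('o \<Rightarrow> 'u \<Rightarrow> 'u) \<Rightarrow> nat \<Rightarrow> 'u" where
  "transpose \<alpha> n = \<alpha> (pt s n) (\<gamma> n (pt s n) (idn X (pt s n)))"

lemma pt_in [simp]: "pt s n \<in> Obj X"
  and tr_in: "m \<le> n \<Longrightarrow> tr s m n \<in> Hom X (pt s m) (pt s n)"
  using s unfolding sequence_in_def by blast+

lemma map_seq_sel [simp]:
  "pt (map_seq (yoneda X) s) n = rep (pt s n)"
  "tr (map_seq (yoneda X) s) m n = far (yoneda X) (pt s m) (pt s n) (tr s m n)"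
  by (simp_all add: map_seq_def)

lemma \<gamma>_in: "\<gamma> n \<in> nat_trans X (rep (pt s n)) \<phi>"
  and \<gamma>_cocone: "m \<le> n \<Longrightarrow> cmp (presheaf_cat X) (rep (pt s m)) (rep (pt s n)) \<phi> (\<gamma> n)
    (far (yoneda X) (pt s m) (pt s n) (tr s m n)) = \<gamma> m"
  and \<phi>_functor: "normed_functor (dual X) SetV \<phi>"
proof -
  have "cocone (accessible_presheaf_cat X) (map_seq (yoneda X) s) \<phi> \<gamma>"
    using \<phi> unfolding normed_colimit_def by (rule conjunct1)
  then show "\<gamma> n \<in> nat_trans X (rep (pt s n)) \<phi>"
    and "m \<le> n \<Longrightarrow> cmp (presheaf_cat X) (rep (pt s m)) (rep (pt s n)) \<phi> (\<gamma> n)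
      (far (yoneda X) (pt s m) (pt s n) (tr s m n)) = \<gamma> m"
    and "normed_functor (dual X) SetV \<phi>"
    unfolding cocone_def by (simp_all, simp add: accessible_presheaf_cat_def presheaf_cat_def)
qed

lemma \<phi>_universal:
  assumes "cocone (accessible_presheaf_cat X) (map_seq (yoneda X) s) P \<delta>"
  shows "\<exists>!\<alpha>. \<alpha> \<in> nat_trans X \<phi> P \<and>
    (\<forall>n. cmp (presheaf_cat X) (rep (pt s n)) \<phi> P \<alpha> (\<gamma> n) = \<delta> n)"
  using \<phi>[unfolded normed_colimit_def, THEN conjunct2, THEN conjunct1, rule_format, OF assms]
  by (simp only: accessible_presheaf_cat_sel map_seq_sel)

lemma \<phi>_norm:
  assumes "P \<in> Obj (accessible_presheaf_cat X)" "\<alpha> \<in> nat_trans X \<phi> P"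
  shows "nat_norm X \<phi> P \<alpha> = (SUP N. INF n\<in>{N..}. nat_norm X (rep (pt s n)) P
    (cmp (presheaf_cat X) (rep (pt s n)) \<phi> P \<alpha> (\<gamma> n)))"
  using \<phi>[unfolded normed_colimit_def, THEN conjunct2, THEN conjunct2, rule_format, OF assms(1)]
    assms(2)
  by (simp only: accessible_presheaf_cat_sel map_seq_sel)

lemma \<gamma>_point: "\<gamma> n (pt s n) (idn X (pt s n)) \<in> elems (fob \<phi> (pt s n))"
  using nat_transD(2)[OF \<gamma>_in pt_in] by simp

text \<open>The Yoneda lemma applied to the composite of \<open>\<alpha>\<close> with
  \<open>\<gamma> n\<close>, whose value at the identity of \<open>pt s n\<close> is the
  transpose.\<close>

lemma cmp_\<gamma>:
  assumes y: "y \<in> Obj X" and \<alpha>: "\<alpha> \<in> nat_trans X \<phi> (rep y)"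
  shows "transpose \<alpha> n \<in> Hom X (pt s n) y"
    and "cmp (presheaf_cat X) (rep (pt s n)) \<phi> (rep y) \<alpha> (\<gamma> n)
      = far (yoneda X) (pt s n) y (transpose \<alpha> n)"
proof -
  let ?\<beta> = "cmp (presheaf_cat X) (rep (pt s n)) \<phi> (rep y) \<alpha> (\<gamma> n)"
  have \<beta>: "?\<beta> \<in> nat_trans X (rep (pt s n)) (rep y)"
    using rep_in_presheaf_cat[OF pt_in]
    by (intro cmp_presheaf_cat_in_nat_trans[OF _ \<gamma>_in \<alpha>]) (simp add: presheaf_cat_def)
  have eq: "?\<beta> (pt s n) (idn X (pt s n)) = transpose \<alpha> n"
    by (simp add: presheaf_cat_def transpose_def compose_def)
  show "transpose \<alpha> n \<in> Hom X (pt s n) y"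
    using yoneda_expand(1)[OF pt_in y \<beta>] unfolding eq .
  show "?\<beta> = far (yoneda X) (pt s n) y (transpose \<alpha> n)"
    using yoneda_expand(2)[OF pt_in y \<beta>] unfolding eq .
qed

text \<open>Functoriality of the embedding carries the cocone equations to presheaves, and
  faithfulness brings them back.\<close>

lemma presheaf_cocone_iff:
  assumes y: "y \<in> Obj X" and \<delta>: "\<And>n. \<delta> n \<in> Hom X (pt s n) y"
  shows "cocone (accessible_presheaf_cat X) (map_seq (yoneda X) s) (rep y)
      (\<lambda>n. far (yoneda X) (pt s n) y (\<delta> n)) \<longleftrightarrow> cocone X s y \<delta>"
proof -
  have "far (yoneda X) (pt s m) y (cmp X (pt s m) (pt s n) y (\<delta> n) (tr s m n))
      = far (yoneda X) (pt s m) y (\<delta> m)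
    \<longleftrightarrow> cmp X (pt s m) (pt s n) y (\<delta> n) (tr s m n) = \<delta> m" if "m \<le> n" for m n
    using yoneda_arrow_inj[OF pt_in y _ \<delta>] \<delta> y tr_in[OF that] by auto
  then show ?thesis
    using y \<delta> yoneda_arrow_in_nat_trans[OF pt_in y \<delta>]
    by (auto simp: cocone_def rep_in_accessible_presheaf_cat cmp_yoneda_arrows tr_in)
qed

text \<open>The cocone equation at the identity of \<open>pt s m\<close> yields the value of
  \<open>\<gamma> n\<close> at \<open>tr s m n\<close>, which naturality of
  \<open>\<gamma> n\<close> turns into a restriction of its point. This compatibility of the points
  makes transposes cocones.\<close>

lemma \<phi>_functor_action:
  assumes "m \<le> n"
  shows "far \<phi> (pt s n) (pt s m) (tr s m n) (\<gamma> n (pt s n) (idn X (pt s n)))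
    = \<gamma> m (pt s m) (idn X (pt s m))"
proof -
  have "\<gamma> m (pt s m) (idn X (pt s m)) = \<gamma> n (pt s m) (tr s m n)"
    using tr_in[OF assms]
    by (subst \<gamma>_cocone[OF assms, symmetric])
      (simp add: presheaf_cat_def compose_def yoneda_def)
  also have "\<dots> = \<gamma> n (pt s m) (far (rep (pt s n)) (pt s n) (pt s m) (tr s m n) (idn X (pt s n)))"
    using tr_in[OF assms] by (simp add: far_rep)
  also have "\<dots> = far \<phi> (pt s n) (pt s m) (tr s m n) (\<gamma> n (pt s n) (idn X (pt s n)))"
    using nat_transD(3)[OF \<gamma>_in pt_in] tr_in[OF assms] by simp
  finally show ?thesis ..
qed

text \<open>Naturality of \<open>\<alpha>\<close> along \<open>tr s m n\<close> carries the
  compatible points given by \<open>\<gamma>\<close> to compatible arrows into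
  \<open>y\<close>.\<close>

lemma transpose_cocone:
  assumes y: "y \<in> Obj X" and \<alpha>: "\<alpha> \<in> nat_trans X \<phi> (rep y)"
  shows "cocone X s y (transpose \<alpha>)"
  unfolding cocone_def
proof (intro conjI allI impI)
  fix m n :: nat assume mn: "m \<le> n"
  have "transpose \<alpha> m = far (rep y) (pt s n) (pt s m) (tr s m n) (transpose \<alpha> n)"
    using nat_transD(3)[OF \<alpha> pt_in pt_in tr_in[OF mn] \<gamma>_point] mn
    by (simp add: transpose_def \<phi>_functor_action)
  then show "cmp X (pt s m) (pt s n) y (transpose \<alpha> n) (tr s m n) = transpose \<alpha> m"
    using cmp_\<gamma>(1)[OF y \<alpha>] by (simp add: far_rep)
qed (rule y, rule cmp_\<gamma>(1)[OF y \<alpha>])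

text \<open>The universal property of \<open>\<phi>\<close>, tested against the accessible presheaf
  \<open>rep y\<close> and translated by the Yoneda lemma.\<close>

lemma transpose_bij:
  assumes y: "y \<in> Obj X"
  shows "bij_betw transpose (nat_trans X \<phi> (rep y)) {\<delta>. cocone X s y \<delta>}"
proof -
  have "\<exists>!\<alpha>. \<alpha> \<in> nat_trans X \<phi> (rep y) \<and> transpose \<alpha> = \<delta>" if \<delta>: "cocone X s y \<delta>" for \<delta>
  proof -
    have \<delta>_in: "\<delta> n \<in> Hom X (pt s n) y" for n
      using \<delta> by (simp add: cocone_def)
    \<comment> \<open>By faithfulness, each equation in the universal property of
      \<open>\<phi>\<close> is an equation between an arrow of the transpose and an arrow of
      \<open>\<delta>\<close>.\<close>
    have "cmp (presheaf_cat X) (rep (pt s n)) \<phi> (rep y) \<alpha> (\<gamma> n) = far (yoneda X) (pt s n) y (\<delta> n)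
        \<longleftrightarrow> transpose \<alpha> n = \<delta> n" if "\<alpha> \<in> nat_trans X \<phi> (rep y)" for \<alpha> n
      using cmp_\<gamma>[OF y that] yoneda_arrow_inj[OF pt_in y _ \<delta>_in] by auto
    moreover have "cocone (accessible_presheaf_cat X) (map_seq (yoneda X) s) (rep y)
        (\<lambda>n. far (yoneda X) (pt s n) y (\<delta> n))"
      using presheaf_cocone_iff[OF y \<delta>_in] \<delta> by blast
    then have "\<exists>!\<alpha>. \<alpha> \<in> nat_trans X \<phi> (rep y) \<and> (\<forall>n. cmp (presheaf_cat X) (rep (pt s n)) \<phi> (rep y)
        \<alpha> (\<gamma> n) = far (yoneda X) (pt s n) y (\<delta> n))"
      by (rule \<phi>_universal)
    ultimately show ?thesis
      by (simp add: fun_eq_iff cong: conj_cong)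
  qed
  then show ?thesis
    using transpose_cocone[OF y] unfolding bij_betw_iff_ex1 by simp
qed

text \<open>In the norm condition on \<open>\<phi>\<close> the composites with
  \<open>\<gamma> n\<close> are Yoneda arrows of transposes, and the embedding preserves
  norms.\<close>

lemma transpose_norm:
  assumes y: "y \<in> Obj X" and \<alpha>: "\<alpha> \<in> nat_trans X \<phi> (rep y)"
  shows "nat_norm X \<phi> (rep y) \<alpha> = (SUP N. INF n\<in>{N..}. nrm X (pt s n) y (transpose \<alpha> n))"
proof -
  show ?thesis
    unfolding \<phi>_norm[OF rep_in_accessible_presheaf_cat[OF y] \<alpha>] cmp_\<gamma>(2)[OF y \<alpha>]
      yoneda_norm[OF pt_in y cmp_\<gamma>(1)[OF y \<alpha>]] ..
qed

section \<open>Passage between weighted and normed colimits\<close>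

text \<open>Surjectivity and injectivity of composition with \<open>c\<close> are existence and
  uniqueness of the mediating arrow.\<close>

lemma normed_colimit_of_bij:
  assumes c: "cocone X s x c"
    and bij: "\<And>y. y \<in> Obj X \<Longrightarrow>
      bij_betw (\<lambda>f n. cmp X (pt s n) x y f (c n)) (Hom X x y) {\<delta>. cocone X s y \<delta>}"
    and norm: "\<And>y f. \<lbrakk>y \<in> Obj X; f \<in> Hom X x y\<rbrakk> \<Longrightarrow>
      nrm X x y f = (SUP N. INF n\<in>{N..}. nrm X (pt s n) y (cmp X (pt s n) x y f (c n)))"
  shows "normed_colimit X s x c"
  unfolding normed_colimit_def
proof (intro conjI allI ballI impI)
  fix y \<delta> assume \<delta>: "cocone X s y \<delta>"
  then have y: "y \<in> Obj X" by (simp add: cocone_def)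
  show "\<exists>!f. f \<in> Hom X x y \<and> (\<forall>n. cmp X (pt s n) x y f (c n) = \<delta> n)"
    using bij[OF y] \<delta> unfolding bij_betw_iff_ex1 by (simp add: fun_eq_iff)
qed (use c norm in auto)

lemma bij_of_normed_colimit:
  assumes col: "normed_colimit X s x c" and y: "y \<in> Obj X"
  shows "bij_betw (\<lambda>f n. cmp X (pt s n) x y f (c n)) (Hom X x y) {\<delta>. cocone X s y \<delta>}"
proof -
  have c: "x \<in> Obj X" "c n \<in> Hom X (pt s n) x"
    "m \<le> n \<Longrightarrow> cmp X (pt s m) (pt s n) x (c n) (tr s m n) = c m" for m n
    using col by (auto simp: normed_colimit_def cocone_def)
  have coc: "cocone X s y (\<lambda>n. cmp X (pt s n) x y f (c n))" if "f \<in> Hom X x y" for f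
    using c y that by (auto simp: cocone_def cmp_assoc tr_in)
  have ex1: "\<exists>!f. f \<in> Hom X x y \<and> (\<lambda>n. cmp X (pt s n) x y f (c n)) = \<delta>"
    if "cocone X s y \<delta>" for \<delta>
    using col that by (simp add: normed_colimit_def fun_eq_iff)
  show ?thesis
    using coc ex1 unfolding bij_betw_iff_ex1 by simp
qed

text \<open>Following \<open>\<theta> y\<close> by transposition represents cocones by arrows out of
  \<open>x\<close>. The image of the identity is the colimit cocone, since naturality of
  \<open>\<theta>\<close> makes every arrow act by composition with it.\<close>

lemma weighted_colimit_imp_normed_colimit:
  assumes w: "weighted_colimit X X \<phi> id_functor x \<theta>"
  shows "normed_colimit X s x (transpose (\<theta> x (idn X x)))"
proof -
  have x: "x \<in> Obj X"
    and bij: "\<And>y. y \<in> Obj X \<Longrightarrow> bij_betw (\<theta> y) (Hom X x y) (nat_trans X \<phi> (rep y))"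
    and norm: "\<And>y f. \<lbrakk>y \<in> Obj X; f \<in> Hom X x y\<rbrakk> \<Longrightarrow> nat_norm X \<phi> (rep y) (\<theta> y f) = nrm X x y f"
    and nat: "\<And>y z f h a t. \<lbrakk>y \<in> Obj X; z \<in> Obj X; f \<in> Hom X x y; h \<in> Hom X y z; a \<in> Obj X;
      t \<in> elems (fob \<phi> a)\<rbrakk> \<Longrightarrow> \<theta> z (cmp X x y z h f) a t = cmp X a y z h (\<theta> y f a t)"
    using w by (simp_all add: weighted_colimit_def id_functor_def)
  let ?c = "transpose (\<theta> x (idn X x))"
  have \<theta>_in: "\<theta> y f \<in> nat_trans X \<phi> (rep y)" if "y \<in> Obj X" "f \<in> Hom X x y" for y f
    using bij_betw_apply[OF bij] that by blast
  \<comment> \<open>Naturality of \<open>\<theta>\<close> along \<open>f\<close>, started from the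
    identity of \<open>x\<close> and evaluated at the point given by
    \<open>\<gamma> n\<close>.\<close>
  have eq: "transpose (\<theta> y f) = (\<lambda>n. cmp X (pt s n) x y f (?c n))"
    if "y \<in> Obj X" "f \<in> Hom X x y" for y f
    using nat[OF x that(1) idn_in[OF x] that(2) pt_in \<gamma>_point] x that
    by (simp add: transpose_def fun_eq_iff)
  show ?thesis
  proof (rule normed_colimit_of_bij)
    show "cocone X s x ?c"
      using transpose_cocone \<theta>_in x by simp
    show "bij_betw (\<lambda>f n. cmp X (pt s n) x y f (?c n)) (Hom X x y) {\<delta>. cocone X s y \<delta>}"
      if "y \<in> Obj X" for y
      using bij_betw_trans[OF bij transpose_bij, OF that that] eq[OF that]
      by (simp add: o_def cong: bij_betw_cong)
    show "nrm X x y f = (SUP N. INF n\<in>{N..}. nrm X (pt s n) y (cmp X (pt s n) x y f (?c n)))"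
      if "y \<in> Obj X" "f \<in> Hom X x y" for y f
      using transpose_norm[OF that(1) \<theta>_in[OF that]] norm[OF that] eq[OF that] by simp
  qed
qed

text \<open>Transposing \<open>c\<close> back yields a universal transformation
  \<open>\<eta>\<close> from \<open>\<phi>\<close> to \<open>rep x\<close>. Composition with
  \<open>\<eta>\<close> serves as \<open>\<theta>\<close>, so that the transpose of
  \<open>\<theta> y f\<close> is \<open>f\<close> composed with \<open>c\<close>.\<close>

lemma normed_colimit_imp_weighted_colimit:
  assumes col: "normed_colimit X s x c"
  shows "\<exists>\<theta>. weighted_colimit X X \<phi> id_functor x \<theta>"
proof -
  have x: "x \<in> Obj X" and c: "cocone X s x c"
    and norm: "\<And>y f. \<lbrakk>y \<in> Obj X; f \<in> Hom X x y\<rbrakk> \<Longrightarrow>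
      nrm X x y f = (SUP N. INF n\<in>{N..}. nrm X (pt s n) y (cmp X (pt s n) x y f (c n)))"
    using col by (auto simp: normed_colimit_def cocone_def)
  obtain \<eta> where \<eta>: "\<eta> \<in> nat_trans X \<phi> (rep x)" and \<eta>_c: "transpose \<eta> = c"
    using transpose_bij[OF x] c unfolding bij_betw_iff_ex1 by blast
  define \<theta> where "\<theta> y f = cmp (presheaf_cat X) \<phi> (rep x) (rep y) (far (yoneda X) x y f) \<eta>" for y f
  have \<theta>_in: "\<theta> y f \<in> nat_trans X \<phi> (rep y)" if "y \<in> Obj X" "f \<in> Hom X x y" for y f
    unfolding \<theta>_def
    using \<phi>_functor \<eta> yoneda_arrow_in_nat_trans[OF x that] by (rule cmp_presheaf_cat_in_nat_trans)
  have \<theta>_apply: "\<theta> y f a t = cmp X a x y f (\<eta> a t)"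
    if "a \<in> Obj X" "t \<in> elems (fob \<phi> a)" for y f a t
    using that nat_transD(2)[OF \<eta> that]
    by (simp add: \<theta>_def presheaf_cat_def yoneda_def compose_def)
  have eq: "transpose (\<theta> y f) = (\<lambda>n. cmp X (pt s n) x y f (c n))" for y f
    unfolding \<eta>_c[symmetric] transpose_def using \<theta>_apply[OF pt_in \<gamma>_point] by simp
  have "weighted_colimit X X \<phi> id_functor x \<theta>"
    unfolding weighted_colimit_def
  proof (intro conjI ballI)
    show "bij_betw (\<theta> y) (Hom X x y) (nat_trans X \<phi> (rep y))" if "y \<in> Obj X" for y
    proof -
      \<comment> \<open>This composite is composition with \<open>c\<close>, hence bijective;
        cancelling the bijection \<open>transpose\<close> leaves \<open>\<theta> y\<close>.\<close>
      have "bij_betw (transpose \<circ> \<theta> y) (Hom X x y) {\<delta>. cocone X s y \<delta>}"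
        using bij_of_normed_colimit[OF col that] by (simp add: o_def eq)
      moreover have "\<theta> y ` Hom X x y \<subseteq> nat_trans X \<phi> (rep y)"
        using \<theta>_in[OF that] by blast
      ultimately show ?thesis
        using bij_betw_comp_iff2[OF transpose_bij[OF that]] by blast
    qed
    show "nat_norm X \<phi> (rep y) (\<theta> y f) = nrm X x y f" if "y \<in> Obj X" "f \<in> Hom X x y" for y f
      using transpose_norm[OF that(1) \<theta>_in[OF that]] norm[OF that] eq by simp
    \<comment> \<open>Naturality amounts to associativity of the composites with
      \<open>\<eta> a t\<close>.\<close>
    show "\<theta> z (cmp X x y z h f) a t = cmp X (fob id_functor a) y z h (\<theta> y f a t)"
      if "y \<in> Obj X" "z \<in> Obj X" "f \<in> Hom X x y" "h \<in> Hom X y z" "a \<in> Obj X"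
        "t \<in> elems (fob \<phi> a)" for y z f h a t
    proof -
      have "\<eta> a t \<in> Hom X a x"
        using nat_transD(2)[OF \<eta> that(5,6)] by simp
      then show ?thesis
        using that x by (simp add: \<theta>_apply id_functor_def cmp_assoc)
    qed
  qed (rule x)
  then show ?thesis by blast
qed

end

end

theorem proposition10p5:
  fixes X :: "('o, 'u::set_universe, 'v::comm_quantale) ncat"
    and s :: "('o, 'u) nseq"
    and \<phi> :: "('o, 'u, 'u, 'v) presheaf"
    and \<gamma> :: "nat \<Rightarrow> 'o \<Rightarrow> 'u \<Rightarrow> 'u"
  assumes "condition_A TYPE('v) \<or> condition_B TYPE('v)"
    and "normed_category X" and "locally_small X"
    and "Cauchy_sequence X s"
    and "normed_colimit (accessible_presheaf_cat X) (map_seq (yoneda X) s) \<phi> \<gamma>"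
  shows "(\<exists>x c. normed_colimit X s x c) \<longleftrightarrow> (\<exists>x \<theta>. weighted_colimit X X \<phi> id_functor x \<theta>)"
proof -
  have "sequence_in X s"
    using assms(4) by (simp add: Cauchy_sequence_def)
  note seq = assms(2,3) this assms(5)
  show ?thesis
    using normed_colimit_imp_weighted_colimit[OF seq] weighted_colimit_imp_normed_colimit[OF seq]
    by blast
qed

end
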